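(* Every $T_{0}$ pre-topological group $G$ is regular.
   Context: A pre-topology on a set $Z$ is a family $\mathscr{T}$ of subsets of $Z$ with $\bigcup\mathscr{T}=Z$ that is closed under arbitrary unions (in particular $\emptyset\in\mathscr{T}$); it need not be closed under finite intersections. Members of $\mathscr{T}$ are called open, their complements closed. A map between pre-topological spaces is pre-continuous if preimages of open sets are open. For a pre-topological space $G$, the product pre-topology on $G\times G$ has as open sets exactly the unions of sets $U\times V$ with $U,V$ open in $G$. A pre-topological group is a group $G$ with a pre-topology such that the multiplication $G\times G\to G$ and the inversion $G\to G$ are pre-continuous. A pre-topological space $Z$ is $T_{0}$ if for any distinct $y,z\in Z$ there is an open $W$ such that $W\cap\{y,z\}$ is a one-point set. It is $T_{1}$ if for any distinct $y,z\in Z$ there are open $V,W$ with $V\cap\{y,z\}=\{y\}$ and $W\cap\{y,z\}=\{z\}$. It is regular if it is $T_{1}$ and for every $z\in Z$ and closed $A\subseteq Z$ with $z\notin A$ there are open $V,O$ with $V\cap O=\emptyset$, $z\in V$, $A\subseteq O$. *)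

theory Defs
  imports "HOL-Algebra.Group"
begin

definition pretopology_on :: "'a set \<Rightarrow> 'a set set \<Rightarrow> bool" where
  "pretopology_on Z T \<longleftrightarrow> \<Union>T = Z \<and> (\<forall>S. S \<subseteq> T \<longrightarrow> \<Union>S \<in> T)"

definition closed_pretop :: "'a set \<Rightarrow> 'a set set \<Rightarrow> 'a set \<Rightarrow> bool" where
  "closed_pretop Z T A \<longleftrightarrow> A \<subseteq> Z \<and> Z - A \<in> T"

definition prod_pretopology :: "'a set set \<Rightarrow> 'b set set \<Rightarrow> ('a \<times> 'b) set set" where
  "prod_pretopology S T = {\<Union>B | B. B \<subseteq> {U \<times> V | U V. U \<in> S \<and> V \<in> T}}"

definition precontinuous ::
  "'a set \<Rightarrow> 'a set set \<Rightarrow> 'b set \<Rightarrow> 'b set set \<Rightarrow> ('a \<Rightarrow> 'b) \<Rightarrow> bool" where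
  "precontinuous X S Y T f \<longleftrightarrow>
     f \<in> X \<rightarrow> Y \<and> (\<forall>V\<in>T. {x \<in> X. f x \<in> V} \<in> S)"

definition T0_pretop :: "'a set \<Rightarrow> 'a set set \<Rightarrow> bool" where
  "T0_pretop Z T \<longleftrightarrow>
     (\<forall>y\<in>Z. \<forall>z\<in>Z. y \<noteq> z \<longrightarrow> (\<exists>W\<in>T. is_singleton (W \<inter> {y, z})))"

definition T1_pretop :: "'a set \<Rightarrow> 'a set set \<Rightarrow> bool" where
  "T1_pretop Z T \<longleftrightarrow>
     (\<forall>y\<in>Z. \<forall>z\<in>Z. y \<noteq> z \<longrightarrow>
        (\<exists>V\<in>T. \<exists>W\<in>T. V \<inter> {y, z} = {y} \<and> W \<inter> {y, z} = {z}))"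

definition regular_pretop :: "'a set \<Rightarrow> 'a set set \<Rightarrow> bool" where
  "regular_pretop Z T \<longleftrightarrow>
     T1_pretop Z T \<and>
     (\<forall>z\<in>Z. \<forall>A. closed_pretop Z T A \<and> z \<notin> A \<longrightarrow>
        (\<exists>V\<in>T. \<exists>W\<in>T. V \<inter> W = {} \<and> z \<in> V \<and> A \<subseteq> W))"

locale pretopological_group = group G for G (structure) +
  fixes T :: "'a set set"
  assumes pretopology: "pretopology_on (carrier G) T"
    and precontinuous_mult:
      "precontinuous (carrier G \<times> carrier G) (prod_pretopology T T) (carrier G) T
         (\<lambda>(x, y). x \<otimes> y)"
    and precontinuous_inv: "precontinuous (carrier G) T (carrier G) T (\<lambda>x. inv x)"

end

theory Submission
  imports Defs
begin

text \<open>
  Separation arguments in topological groups usually shrink a neighbourhood of the identity to a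
  symmetric one by intersecting it with its inverse, and that intersection need not be open here.
  Two observations avoid intersections altogether.

  First, the maps \<open>x \<mapsto> a \<otimes> inv x \<otimes> b\<close> are pre-continuous (\<open>preimage_inv_translate_open\<close>).
  The one with \<open>a = y\<close> and \<open>b = z\<close> exchanges \<open>y\<close> and \<open>z\<close>, so an open set that
  contains one of two points and misses the other has a mirror image that does the opposite. Hence
  \<open>T\<^sub>0\<close> implies \<open>T\<^sub>1\<close>.

  Second, let \<open>A\<close> be closed and \<open>z \<notin> A\<close>. Pre-continuity of the multiplication at the pair
  \<open>(z, \<one>)\<close> gives open sets \<open>U\<close> around \<open>z\<close> and \<open>V\<close> around \<open>\<one>\<close> with all products
  \<open>u \<otimes> v\<close> outside \<open>A\<close>. Then \<open>U\<close> is disjoint from the set of all \<open>a \<otimes> inv v\<close> with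
  \<open>a \<in> A\<close> and \<open>v \<in> V\<close>, which contains \<open>A\<close> and is open as a union of preimages of \<open>V\<close>.
\<close>

lemma pretopology_on_subset: "pretopology_on Z T \<Longrightarrow> U \<in> T \<Longrightarrow> U \<subseteq> Z"
  unfolding pretopology_on_def by blast

lemma pretopology_on_Union: "pretopology_on Z T \<Longrightarrow> S \<subseteq> T \<Longrightarrow> \<Union>S \<in> T"
  unfolding pretopology_on_def by blast

text \<open>Openness can still be tested pointwise, because the test only uses unions.\<close>

lemma pretopology_on_open_local:
  assumes "pretopology_on Z T"
    and "\<And>x. x \<in> S \<Longrightarrow> \<exists>U\<in>T. x \<in> U \<and> U \<subseteq> S"
  shows "S \<in> T"
proof -
  have "S = \<Union>{U \<in> T. U \<subseteq> S}"
    using assms(2) by blast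
  also have "\<dots> \<in> T"
    using assms(1) by (rule pretopology_on_Union) blast
  finally show ?thesis .
qed

lemma precontinuous_preimage:
  "precontinuous X S Y T f \<Longrightarrow> V \<in> T \<Longrightarrow> {x \<in> X. f x \<in> V} \<in> S"
  unfolding precontinuous_def by blast

lemma prod_pretopology_box:
  assumes "W \<in> prod_pretopology S T" and "(a, b) \<in> W"
  obtains U V where "U \<in> S" "V \<in> T" "a \<in> U" "b \<in> V" "U \<times> V \<subseteq> W"
proof -
  obtain B where W: "W = \<Union>B" and B: "B \<subseteq> {U \<times> V | U V. U \<in> S \<and> V \<in> T}"
    using assms(1) unfolding prod_pretopology_def by blast
  obtain P where "P \<in> B" "(a, b) \<in> P"
    using assms(2) W by blast
  moreover from \<open>P \<in> B\<close> B obtain U V where "P = U \<times> V" "U \<in> S" "V \<in> T"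
    by blast
  ultimately show thesis
    using that W by blast
qed

context pretopological_group
begin

lemma mult_neighbourhoods:
  assumes "W \<in> T" "a \<in> carrier G" "b \<in> carrier G" "a \<otimes> b \<in> W"
  obtains U V where "U \<in> T" "V \<in> T" "a \<in> U" "b \<in> V"
    "\<forall>u\<in>U. \<forall>v\<in>V. u \<otimes> v \<in> W"
proof -
  let ?P = "{p \<in> carrier G \<times> carrier G. (case p of (x, y) \<Rightarrow> x \<otimes> y) \<in> W}"
  have "?P \<in> prod_pretopology T T"
    using precontinuous_mult assms(1) by (rule precontinuous_preimage)
  moreover have "(a, b) \<in> ?P"
    using assms by simp
  ultimately obtain U V
    where "U \<in> T" "V \<in> T" "a \<in> U" "b \<in> V" and "U \<times> V \<subseteq> ?P"
    by (rule prod_pretopology_box)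
  note \<open>U \<in> T\<close> \<open>V \<in> T\<close> \<open>a \<in> U\<close> \<open>b \<in> V\<close>
  moreover from \<open>U \<times> V \<subseteq> ?P\<close> have "\<forall>u\<in>U. \<forall>v\<in>V. u \<otimes> v \<in> W"
    by auto
  ultimately show thesis
    by (rule that)
qed

text \<open>
  Joint pre-continuity gives separate pre-continuity: discard the neighbourhood of the fixed
  factor.
\<close>

lemma preimage_left_translate_open:
  assumes "W \<in> T" "a \<in> carrier G"
  shows "{x \<in> carrier G. a \<otimes> x \<in> W} \<in> T"
proof (rule pretopology_on_open_local[OF pretopology])
  fix x assume "x \<in> {x \<in> carrier G. a \<otimes> x \<in> W}"
  then have "x \<in> carrier G" "a \<otimes> x \<in> W"
    by auto
  from assms this obtain U V where "U \<in> T" "V \<in> T" "a \<in> U" "x \<in> V"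
    and "\<forall>u\<in>U. \<forall>v\<in>V. u \<otimes> v \<in> W"
    by (rule mult_neighbourhoods)
  then show "\<exists>V\<in>T. x \<in> V \<and> V \<subseteq> {x \<in> carrier G. a \<otimes> x \<in> W}"
    using pretopology_on_subset[OF pretopology] by blast
qed

lemma preimage_right_translate_open:
  assumes "W \<in> T" "b \<in> carrier G"
  shows "{x \<in> carrier G. x \<otimes> b \<in> W} \<in> T"
proof (rule pretopology_on_open_local[OF pretopology])
  fix x assume "x \<in> {x \<in> carrier G. x \<otimes> b \<in> W}"
  then have "x \<in> carrier G" "x \<otimes> b \<in> W"
    by auto
  from assms(1) this(1) assms(2) this(2) obtain U V
    where "U \<in> T" "V \<in> T" "x \<in> U" "b \<in> V"
    and "\<forall>u\<in>U. \<forall>v\<in>V. u \<otimes> v \<in> W"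
    by (rule mult_neighbourhoods)
  then show "\<exists>U\<in>T. x \<in> U \<and> U \<subseteq> {x \<in> carrier G. x \<otimes> b \<in> W}"
    using pretopology_on_subset[OF pretopology] by blast
qed

text \<open>
  With \<open>a = y\<close> and \<open>b = z\<close> this is the map exchanging \<open>y\<close> and \<open>z\<close>; with \<open>a = \<one>\<close>
  and \<open>b \<in> A\<close> it yields the translates of \<open>V\<close>'s inverse that cover a closed set \<open>A\<close>.
\<close>

lemma preimage_inv_translate_open:
  assumes "W \<in> T" "a \<in> carrier G" "b \<in> carrier G"
  shows "{x \<in> carrier G. a \<otimes> inv x \<otimes> b \<in> W} \<in> T"
proof -
  let ?R = "{x \<in> carrier G. x \<otimes> b \<in> W}"
  let ?L = "{x \<in> carrier G. a \<otimes> x \<in> ?R}"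
  have "?L \<in> T"
    using assms by (intro preimage_left_translate_open preimage_right_translate_open)
  then have "{x \<in> carrier G. inv x \<in> ?L} \<in> T"
    by (rule precontinuous_preimage[OF precontinuous_inv])
  also have "{x \<in> carrier G. inv x \<in> ?L} = {x \<in> carrier G. a \<otimes> inv x \<otimes> b \<in> W}"
    using assms by auto
  finally show ?thesis .
qed

lemma mirror_separating_open:
  assumes "W \<in> T" "y \<in> carrier G" "z \<in> carrier G" "y \<in> W" "z \<notin> W"
  obtains W' where "W' \<in> T" "z \<in> W'" "y \<notin> W'"
proof (rule that)
  let ?W' = "{x \<in> carrier G. y \<otimes> inv x \<otimes> z \<in> W}"
  show "?W' \<in> T"
    using assms by (intro preimage_inv_translate_open)
  show "z \<in> ?W'"
    using assms by (simp add: m_assoc)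
  show "y \<notin> ?W'"
    using assms by simp
qed

lemma T0_imp_T1:
  assumes "T0_pretop (carrier G) T"
  shows "T1_pretop (carrier G) T"
  unfolding T1_pretop_def
proof (intro ballI impI)
  fix y z assume yz: "y \<in> carrier G" "z \<in> carrier G" "y \<noteq> z"
  then obtain W where W: "W \<in> T" and "is_singleton (W \<inter> {y, z})"
    using assms unfolding T0_pretop_def by blast
  then obtain w where "W \<inter> {y, z} = {w}"
    by (auto elim: is_singletonE)
  with yz(3) have "y \<in> W \<and> z \<notin> W \<or> z \<in> W \<and> y \<notin> W"
    by (cases "y \<in> W"; cases "z \<in> W") auto
  then consider "y \<in> W" "z \<notin> W" | "z \<in> W" "y \<notin> W"
    by blast
  then show "\<exists>V\<in>T. \<exists>W\<in>T. V \<inter> {y, z} = {y} \<and> W \<inter> {y, z} = {z}"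
  proof cases
    case 1
    from W yz(1,2) 1 obtain W' where "W' \<in> T" "z \<in> W'" "y \<notin> W'"
      by (rule mirror_separating_open)
    with 1 W show ?thesis by blast
  next
    case 2
    from W yz(2,1) 2 obtain W' where "W' \<in> T" "y \<in> W'" "z \<notin> W'"
      by (rule mirror_separating_open)
    with 2 W show ?thesis by blast
  qed
qed

lemma separate_point_closed:
  assumes "z \<in> carrier G" "closed_pretop (carrier G) T A" "z \<notin> A"
  shows "\<exists>V\<in>T. \<exists>W\<in>T. V \<inter> W = {} \<and> z \<in> V \<and> A \<subseteq> W"
proof -
  have A: "A \<subseteq> carrier G" "carrier G - A \<in> T"
    using assms(2) unfolding closed_pretop_def by auto
  have "z \<otimes> \<one> \<in> carrier G - A"
    using assms by simp
  from A(2) assms(1) one_closed this obtain U V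
    where U: "U \<in> T" and V: "V \<in> T" and zU: "z \<in> U" and oneV: "\<one> \<in> V"
    and UV: "\<forall>u\<in>U. \<forall>v\<in>V. u \<otimes> v \<in> carrier G - A"
    by (rule mult_neighbourhoods)
  \<comment> \<open>\<open>x\<close> has the form \<open>a \<otimes> inv v\<close> with \<open>v \<in> V\<close> iff \<open>inv x \<otimes> a \<in> V\<close>.\<close>
  define N where "N a = {x \<in> carrier G. \<one> \<otimes> inv x \<otimes> a \<in> V}" for a
  have "\<Union>(N ` A) \<in> T"
  proof (rule pretopology_on_Union[OF pretopology])
    show "N ` A \<subseteq> T"
      unfolding N_def using A(1) V by (auto intro: preimage_inv_translate_open)
  qed
  moreover have "A \<subseteq> \<Union>(N ` A)"
    unfolding N_def using A(1) oneV by (force simp: subset_iff)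
  moreover have "U \<inter> \<Union>(N ` A) = {}"
  proof (rule ccontr)
    assume "U \<inter> \<Union>(N ` A) \<noteq> {}"
    then obtain x a where x: "x \<in> U" "x \<in> carrier G" and a: "a \<in> A"
      and "inv x \<otimes> a \<in> V"
      unfolding N_def by auto
    then have "x \<otimes> (inv x \<otimes> a) \<notin> A"
      using UV by blast
    moreover have "x \<otimes> (inv x \<otimes> a) = a"
      using x a A(1) by (simp add: subset_iff m_assoc[symmetric])
    ultimately show False
      using a by simp
  qed
  ultimately show ?thesis
    using U zU by blast
qed

end

theorem theorem3p16:
  fixes G :: "('a, 'b) monoid_scheme" and T :: "'a set set"
  assumes "pretopological_group G T"
    and "T0_pretop (carrier G) T"
  shows "regular_pretop (carrier G) T"
proof -
  interpret pretopological_group G T by fact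
  show ?thesis
    unfolding regular_pretop_def
    using T0_imp_T1[OF assms(2)] separate_point_closed by blast
qed

end
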